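(* Let $\rho(a,b)\subset\mathbb{R}^3$ be a unit rhombus with diagonals $a,b>0$. Suppose $\rho(a,b)$ can be domed. Then there is a nonzero polynomial $P\in\mathbb{Q}[x,y]$ such that $P(a^2,b^2)=0$.
   Context: A unit rhombus is a closed polygon $[v_1v_2v_3v_4]$ in $\mathbb{R}^3$ with $|v_1v_2|=|v_2v_3|=|v_3v_4|=|v_4v_1|=1$; its diagonals are $a=|v_1v_3|$ and $b=|v_2v_4|$, and $\rho(a,b)$ denotes the unit rhombus with these diagonals (determined up to rigid motion; necessarily $a^2+b^2\le 4$). A closed polygon with unit edges $\gamma=[v_1\dots v_n]$ can be domed if there is a dome over it: a finite connected 2-dimensional simplicial complex $\Sigma$ which is a compact surface (orientable or not, any genus) whose boundary is a single cycle, together with a map $f:\Sigma\to\mathbb{R}^3$ that is linear on each simplex, sends every triangle to an equilateral triangle of side length $1$, and sends the boundary cycle of $\Sigma$ onto $\gamma$, vertex by vertex in cyclic order. No embedding or immersion condition is imposed. *)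

theory Defs
  imports "HOL-Analysis.Analysis" "HOL-Computational_Algebra.Polynomial"
begin

text \<open>A pure 2-dimensional simplicial complex is given by its set of triangles
  (3-element vertex sets); its vertices and edges are the faces of the triangles.\<close>

definition cplx_edges :: "'v set set \<Rightarrow> 'v set set" where
  "cplx_edges T = {e. card e = 2 \<and> (\<exists>t\<in>T. e \<subseteq> t)}"

definition edge_deg :: "'v set set \<Rightarrow> 'v set \<Rightarrow> nat" where
  "edge_deg T e = card {t\<in>T. e \<subseteq> t}"

definition link_edges :: "'v set set \<Rightarrow> 'v \<Rightarrow> 'v set set" where
  "link_edges T v = {t - {v} | t. t \<in> T \<and> v \<in> t}"

definition link_verts :: "'v set set \<Rightarrow> 'v \<Rightarrow> 'v set" where
  "link_verts T v = \<Union>(link_edges T v)"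

definition graph_connected :: "'v set \<Rightarrow> 'v set set \<Rightarrow> bool" where
  "graph_connected V E \<longleftrightarrow> (\<forall>x\<in>V. \<forall>y\<in>V. (\<lambda>u u'. {u, u'} \<in> E)\<^sup>*\<^sup>* x y)"

text \<open>Combinatorial triangulated compact connected surface (possibly with boundary):
  every edge lies in one or two triangles and the link of every vertex is connected
  (hence a path or a cycle).\<close>
definition triangulated_surface :: "'v set set \<Rightarrow> bool" where
  "triangulated_surface T \<longleftrightarrow>
     finite T \<and> T \<noteq> {} \<and> (\<forall>t\<in>T. card t = 3) \<and>
     graph_connected (\<Union>T) (cplx_edges T) \<and>
     (\<forall>e\<in>cplx_edges T. edge_deg T e = 1 \<or> edge_deg T e = 2) \<and>
     (\<forall>v\<in>\<Union>T. graph_connected (link_verts T v) (link_edges T v))"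

definition boundary_edges :: "'v set set \<Rightarrow> 'v set set" where
  "boundary_edges T = {e \<in> cplx_edges T. edge_deg T e = 1}"

definition boundary_cycle :: "'v set set \<Rightarrow> nat \<Rightarrow> (nat \<Rightarrow> 'v) \<Rightarrow> bool" where
  "boundary_cycle T n w \<longleftrightarrow> 3 \<le> n \<and> inj_on w {..<n} \<and>
     boundary_edges T = {{w i, w ((i + 1) mod n)} | i. i < n}"

text \<open>A dome over the closed unit polygon gamma 0, ..., gamma (n-1): a triangulated surface
  T with single boundary cycle and a vertex map f (extended linearly on simplices) sending
  every triangle to a unit equilateral triangle, and the boundary cycle onto gamma.\<close>
definition is_dome :: "'v set set \<Rightarrow> ('v \<Rightarrow> real^3) \<Rightarrow> nat \<Rightarrow> (nat \<Rightarrow> real^3) \<Rightarrow> bool" where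
  "is_dome T f n \<gamma> \<longleftrightarrow> triangulated_surface T \<and>
     (\<forall>t\<in>T. \<forall>x\<in>t. \<forall>y\<in>t. x \<noteq> y \<longrightarrow> dist (f x) (f y) = 1) \<and>
     (\<exists>w. boundary_cycle T n w \<and> (\<forall>i<n. f (w i) = \<gamma> i))"

definition can_be_domed :: "nat \<Rightarrow> (nat \<Rightarrow> real^3) \<Rightarrow> bool" where
  "can_be_domed n \<gamma> \<longleftrightarrow> (\<exists>(T :: nat set set) f. is_dome T f n \<gamma>)"

definition unit_rhombus :: "(nat \<Rightarrow> real^3) \<Rightarrow> real \<Rightarrow> real \<Rightarrow> bool" where
  "unit_rhombus v a b \<longleftrightarrow>
     dist (v 0) (v 1) = 1 \<and> dist (v 1) (v 2) = 1 \<and> dist (v 2) (v 3) = 1 \<and>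
     dist (v 3) (v 0) = 1 \<and> dist (v 0) (v 2) = a \<and> dist (v 1) (v 3) = b"

text \<open>Q[x,y] represented as (Q[x])[y]; eval2 P x y evaluates at (x,y).\<close>
definition eval2 :: "rat poly poly \<Rightarrow> real \<Rightarrow> real \<Rightarrow> real" where
  "eval2 P x y = poly (map_poly (\<lambda>q. poly (map_poly real_of_rat q) x) P) y"

end

theory Submission
  imports Defs
begin

text \<open>
  Suppose \<open>a\<^sup>2\<close> and \<open>b\<^sup>2\<close> were algebraically independent over \<open>\<rat>\<close>. Then \<open>1/a\<^sup>2\<close> and \<open>1/b\<^sup>2\<close>
  generate a proper ideal of \<open>\<rat>[1/a\<^sup>2, 1/b\<^sup>2]\<close>, so some valuation ring \<open>R\<close> of \<open>\<real>\<close> contains \<open>\<rat>\<close>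
  but neither \<open>a\<^sup>2\<close> nor \<open>b\<^sup>2\<close>. Call two points near if their squared distance lies in \<open>R\<close>; the
  endpoints of every edge of the dome are near. If \<open>x\<^sub>0, x\<^sub>1, \<dots>\<close> is a walk through near pairs whose
  points are all near a point \<open>u\<close>, while no \<open>x\<^sub>i, x\<^sub>i\<^sub>+\<^sub>2\<close> are near, then the linear dependence of any
  four vectors of \<open>\<real>\<^sup>3\<close> forces the inner products \<open>(x\<^sub>0 - u) \<bullet> (x\<^sub>k - u)\<close> to grow in the
  valuation, so the walk never returns. Hence every mod 2 cycle in the link of \<open>u\<close> can be
  shortened step by step and bounds a mod 2 chain of near triangles inside the link. Regarding the
  dome as a mod 2 chain bounded by the rhombus, its interior vertices are therefore eliminated one
  at a time, until a near triangle on the four vertices of the rhombus remains; it contains a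
  diagonal, so \<open>a\<^sup>2 \<in> R\<close> or \<open>b\<^sup>2 \<in> R\<close>.
\<close>

section \<open>Subrings and ideals\<close>

locale subring =
  fixes R :: "'a::comm_ring_1 set"
  assumes one_mem: "1 \<in> R"
    and diff_mem: "x \<in> R \<Longrightarrow> y \<in> R \<Longrightarrow> x - y \<in> R"
    and mult_mem: "x \<in> R \<Longrightarrow> y \<in> R \<Longrightarrow> x * y \<in> R"
begin

lemma zero_mem: "0 \<in> R"
  using diff_mem[OF one_mem one_mem] by simp

lemma uminus_mem: "x \<in> R \<Longrightarrow> - x \<in> R"
  using diff_mem[OF zero_mem] by simp

lemma add_mem: "x \<in> R \<Longrightarrow> y \<in> R \<Longrightarrow> x + y \<in> R"
  using diff_mem[OF _ uminus_mem] by fastforce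

lemma sum_mem: "(\<And>i. i \<in> A \<Longrightarrow> f i \<in> R) \<Longrightarrow> sum f A \<in> R"
  by (induction A rule: infinite_finite_induct) (simp_all add: zero_mem add_mem)

lemma power_mem: "x \<in> R \<Longrightarrow> x ^ n \<in> R"
  by (induction n) (simp_all add: one_mem mult_mem)

lemmas closed = zero_mem one_mem uminus_mem add_mem diff_mem mult_mem

end

inductive_set generated_ideal :: "'a::comm_ring_1 set \<Rightarrow> 'a set \<Rightarrow> 'a set" for R S where
  zero: "0 \<in> generated_ideal R S"
| mult_add: "s \<in> S \<Longrightarrow> r \<in> R \<Longrightarrow> x \<in> generated_ideal R S \<Longrightarrow> s * r + x \<in> generated_ideal R S"

lemma generated_ideal_add:
  "x \<in> generated_ideal R S \<Longrightarrow> y \<in> generated_ideal R S \<Longrightarrow> x + y \<in> generated_ideal R S"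
  by (induction rule: generated_ideal.induct) (auto simp: add.assoc intro: generated_ideal.intros)

lemma generated_ideal_sum:
  "(\<And>i. i \<in> A \<Longrightarrow> f i \<in> generated_ideal R S) \<Longrightarrow> sum f A \<in> generated_ideal R S"
  by (induction A rule: infinite_finite_induct)
     (simp_all add: generated_ideal.zero generated_ideal_add)

lemma generated_ideal_mono: "R \<subseteq> R' \<Longrightarrow> generated_ideal R S \<subseteq> generated_ideal R' S"
proof
  show "x \<in> generated_ideal R' S" if "R \<subseteq> R'" "x \<in> generated_ideal R S" for x
    using that(2,1) by induction (auto intro: generated_ideal.intros)
qed

context subring
begin

lemma generated_ideal_mult:
  assumes "x \<in> generated_ideal R S" "r \<in> R"
  shows "x * r \<in> generated_ideal R S"
  using assms by induction
    (auto simp: distrib_right mult.assoc mult_mem intro: generated_ideal.intros)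

lemma generator_mem_generated_ideal: "s \<in> S \<Longrightarrow> s \<in> generated_ideal R S"
  using generated_ideal.mult_add[OF _ one_mem generated_ideal.zero] by fastforce

lemma generated_ideal_subset: "S \<subseteq> R \<Longrightarrow> generated_ideal R S \<subseteq> R"
proof
  show "x \<in> R" if "S \<subseteq> R" "x \<in> generated_ideal R S" for x
    using that(2,1) by induction (auto simp: closed)
qed

lemma generated_ideal_pair_subset:
  "generated_ideal R {x, y} \<subseteq> {x * r + y * s | r s. r \<in> R \<and> s \<in> R}"
proof
  fix z assume "z \<in> generated_ideal R {x, y}"
  then show "z \<in> {x * r + y * s | r s. r \<in> R \<and> s \<in> R}"
  proof induction
    case zero
    have "0 = x * 0 + y * 0" by simp
    then show ?case using zero_mem by blast
  next
    case (mult_add t r z)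
    then obtain p q where pq: "p \<in> R" "q \<in> R" "z = x * p + y * q" by blast
    from mult_add.hyps(1) consider "t = x" | "t = y" by blast
    then show ?case
    proof cases
      case 1
      then have "t * r + z = x * (r + p) + y * q" using pq(3) by (simp add: distrib_left)
      then show ?thesis using pq add_mem[OF mult_add.hyps(2) pq(1)] by blast
    next
      case 2
      then have "t * r + z = x * p + y * (r + q)" using pq(3) by (simp add: distrib_left)
      then show ?thesis using pq add_mem[OF mult_add.hyps(2) pq(2)] by blast
    qed
  qed
qed

end

text \<open>For a subring \<open>R\<close>, \<open>poly_values R x\<close> is \<open>R[x]\<close>.\<close>

definition poly_values :: "'a::comm_ring_1 set \<Rightarrow> 'a \<Rightarrow> 'a set" where
  "poly_values A x = {poly p x | p. \<forall>i. coeff p i \<in> A}"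

lemma poly_valuesI: "(\<And>i. coeff p i \<in> A) \<Longrightarrow> y = poly p x \<Longrightarrow> y \<in> poly_values A x"
  by (auto simp: poly_values_def)

context subring
begin

lemma subset_poly_values: "R \<subseteq> poly_values R x"
  by (intro subsetI poly_valuesI[of "[:r:]" for r])
     (auto simp: coeff_pCons zero_mem split: nat.split)

lemma self_mem_poly_values: "x \<in> poly_values R x"
  by (rule poly_valuesI[of "[:0, 1:]"]) (auto simp: coeff_pCons closed split: nat.split)

lemma subring_poly_values: "subring (poly_values R x)"
proof
  show "1 \<in> poly_values R x" using one_mem subset_poly_values by blast
  fix y z assume "y \<in> poly_values R x" "z \<in> poly_values R x"
  then obtain p q where p: "\<forall>i. coeff p i \<in> R" "y = poly p x"
    and q: "\<forall>i. coeff q i \<in> R" "z = poly q x"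
    by (auto simp: poly_values_def)
  show "y - z \<in> poly_values R x"
    using p q by (intro poly_valuesI[of "p - q"]) (auto simp: diff_mem)
  show "y * z \<in> poly_values R x"
    using p q by (intro poly_valuesI[of "p * q"]) (auto simp: coeff_mult intro!: sum_mem mult_mem)
qed

end

lemma generated_ideal_poly_values:
  "generated_ideal (poly_values R x) S \<subseteq> poly_values (generated_ideal R S) x"
proof
  fix y assume "y \<in> generated_ideal (poly_values R x) S"
  then show "y \<in> poly_values (generated_ideal R S) x"
  proof induction
    case zero
    show ?case by (rule poly_valuesI[of 0]) (auto intro: generated_ideal.zero)
  next
    case (mult_add s r y)
    then obtain p q where p: "\<forall>i. coeff p i \<in> R" "r = poly p x"
      and q: "\<forall>i. coeff q i \<in> generated_ideal R S" "y = poly q x"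
      by (auto simp: poly_values_def)
    with \<open>s \<in> S\<close> show ?case
      by (intro poly_valuesI[of "smult s p + q"]) (auto intro: generated_ideal.mult_add)
  qed
qed

lemma subring_Union_chain:
  assumes "C \<noteq> {}" "subset.chain {R. subring R} C"
  shows "subring (\<Union>C)"
proof -
  have subrings: "subring R" if "R \<in> C" for R
    using assms(2) that by (auto simp: subset_chain_def)
  have common: "\<exists>R\<in>C. x \<in> R \<and> y \<in> R" if "x \<in> \<Union>C" "y \<in> \<Union>C" for x y
    using assms(2) that unfolding subset_chain_def by blast
  show ?thesis
  proof
    show "1 \<in> \<Union>C" using assms(1) subrings subring.one_mem by blast
    fix x y assume "x \<in> \<Union>C" "y \<in> \<Union>C"
    then obtain R where "R \<in> C" "x \<in> R" "y \<in> R" using common by blast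
    then show "x - y \<in> \<Union>C" "x * y \<in> \<Union>C"
      using subring.diff_mem[OF subrings] subring.mult_mem[OF subrings] by blast+
  qed
qed

lemma generated_ideal_Union_chain:
  assumes "C \<noteq> {}" "subset.chain \<A> C" "x \<in> generated_ideal (\<Union>C) S"
  shows "\<exists>R\<in>C. x \<in> generated_ideal R S"
  using assms(3)
proof induction
  case zero
  then show ?case using assms(1) by (auto intro: generated_ideal.zero)
next
  case (mult_add s r x)
  then obtain A B where AB: "A \<in> C" "r \<in> A" "B \<in> C" "x \<in> generated_ideal B S" by blast
  then have "A \<union> B \<in> C" using assms(2) unfolding subset_chain_def by (metis sup.absorb1 sup.absorb2)
  moreover have "x \<in> generated_ideal (A \<union> B) S"
    using AB(4) generated_ideal_mono[of B "A \<union> B"] by blast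
  ultimately show ?case using AB(2) mult_add.hyps(1) generated_ideal.mult_add by blast
qed

section \<open>Existence of valuation rings\<close>

locale valuation_subring = subring R for R :: "'a::field set" +
  assumes total: "x \<in> R \<or> inverse x \<in> R"

locale maximal_subring_with_proper_ideal = subring R for R :: "'a::field set" +
  fixes S :: "'a set"
  assumes generators_subset: "S \<subseteq> R"
    and proper: "1 \<notin> generated_ideal R S"
    and maximal: "subring R' \<Longrightarrow> R \<subseteq> R' \<Longrightarrow> 1 \<notin> generated_ideal R' S \<Longrightarrow> R' = R"
begin

abbreviation J :: "'a set" where
  "J \<equiv> generated_ideal R S"

lemma ideal_subset: "J \<subseteq> R"
  by (rule generated_ideal_subset[OF generators_subset])

definition unit_relation :: "nat \<Rightarrow> 'a \<Rightarrow> bool" where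
  "unit_relation n x \<longleftrightarrow> (\<exists>c. (\<forall>i. c i \<in> J) \<and> (\<Sum>i\<le>n. c i * x ^ i) = 1)"

lemma not_unit_relation_0: "\<not> unit_relation 0 x"
proof
  assume "unit_relation 0 x"
  then obtain c where c: "\<forall>i. c i \<in> J" "(\<Sum>i\<le>0. c i * x ^ i) = 1"
    unfolding unit_relation_def by blast
  then have "c 0 = 1" by simp
  then show False using c(1) proper by metis
qed

lemma unit_relation_mono:
  assumes "unit_relation m x" "m \<le> n"
  shows "unit_relation n x"
proof -
  obtain c where c: "\<forall>i. c i \<in> J" "(\<Sum>i\<le>m. c i * x ^ i) = 1"
    using assms(1) unfolding unit_relation_def by blast
  define d where "d i = (if i \<le> m then c i else 0)" for i
  have "(\<Sum>i\<le>n. d i * x ^ i) = (\<Sum>i\<le>m. c i * x ^ i)"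
    using assms(2) by (intro sum.mono_neutral_cong_right) (auto simp: d_def)
  moreover have "\<forall>i. d i \<in> J" using c(1) by (simp add: d_def generated_ideal.zero)
  ultimately show ?thesis using c(2) unfolding unit_relation_def by metis
qed

lemma exists_unit_relation:
  assumes "x \<notin> R"
  shows "\<exists>n. unit_relation n x"
proof -
  have "poly_values R x \<noteq> R" using assms self_mem_poly_values by blast
  then have "1 \<in> generated_ideal (poly_values R x) S"
    using maximal[OF subring_poly_values subset_poly_values] by blast
  then have "1 \<in> poly_values J x" using generated_ideal_poly_values by blast
  then obtain p where "\<forall>i. coeff p i \<in> J" "poly p x = 1" by (auto simp: poly_values_def)
  then have "unit_relation (degree p) x" unfolding unit_relation_def poly_altdef by blast
  then show ?thesis by blast
qed

lemma power_relation_if_unit_relation_inverse: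
  assumes "x \<noteq> 0" "unit_relation n (inverse x)"
  shows "\<exists>c. (\<forall>i. c i \<in> J) \<and> x ^ n = (\<Sum>i\<le>n. c i * x ^ i)"
proof -
  obtain c where c: "\<forall>i. c i \<in> J" "(\<Sum>i\<le>n. c i * inverse x ^ i) = 1"
    using assms(2) unfolding unit_relation_def by blast
  have scaled: "x ^ n * (c i * inverse x ^ i) = c i * x ^ (n - i)" if "i \<le> n" for i
  proof -
    have "x ^ n = x ^ (n - i) * x ^ i" using that by (simp flip: power_add)
    then show ?thesis using \<open>x \<noteq> 0\<close> by (simp add: power_inverse)
  qed
  have "x ^ n = x ^ n * (\<Sum>i\<le>n. c i * inverse x ^ i)" using c(2) by simp
  also have "\<dots> = (\<Sum>i\<le>n. c i * x ^ (n - i))"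
    unfolding sum_distrib_left using scaled by (intro sum.cong) auto
  also have "\<dots> = (\<Sum>i\<le>n. c (n - i) * x ^ i)"
    by (rule sum.reindex_bij_witness[of _ "\<lambda>i. n - i" "\<lambda>i. n - i"]) auto
  finally show ?thesis using c(1) by (intro exI[of _ "\<lambda>i. c (n - i)"]) simp
qed

lemma inverse_one_minus_mem:
  assumes "j \<in> J"
  shows "inverse (1 - j) \<in> R"
proof (rule ccontr)
  let ?u = "1 - j"
  assume "inverse ?u \<notin> R"
  then obtain n where n: "unit_relation n (inverse ?u)" using exists_unit_relation by blast
  have u: "?u \<in> R" using assms ideal_subset by (auto intro: closed)
  have "?u \<noteq> 0" using assms proper by auto
  then obtain c where c: "\<forall>i. c i \<in> J" "?u ^ n = (\<Sum>i\<le>n. c i * ?u ^ i)"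
    using power_relation_if_unit_relation_inverse[OF _ n] by blast
  have "?u ^ n \<in> J"
    unfolding c(2) by (intro generated_ideal_sum generated_ideal_mult c(1)[rule_format] power_mem u)
  moreover have "1 - ?u ^ n \<in> J"
    using generated_ideal_mult[OF assms sum_mem[of "{..<n}", OF power_mem[OF u]]]
    by (simp add: one_diff_power_eq)
  ultimately have "1 - ?u ^ n + ?u ^ n \<in> J" using generated_ideal_add by blast
  then show False using proper by simp
qed

text \<open>Chevalley's exchange step: the leading term of the relation for \<open>x\<close> is rewritten with the
  relation for \<open>1/x\<close>.\<close>

lemma unit_relation_descent:
  assumes "x \<noteq> 0" "unit_relation n x" "unit_relation n (inverse x)"
  shows "\<exists>m<n. unit_relation m x"
proof (cases n)
  case 0
  then show ?thesis using assms(2) not_unit_relation_0 by blast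
next
  case (Suc m)
  obtain c where c: "\<forall>i. c i \<in> J" "(\<Sum>i\<le>n. c i * x ^ i) = 1"
    using assms(2) unfolding unit_relation_def by blast
  obtain d where d: "\<forall>i. d i \<in> J" "x ^ n = (\<Sum>i\<le>n. d i * x ^ i)"
    using power_relation_if_unit_relation_inverse[OF assms(1,3)] by blast
  define u where "u = inverse (1 - d n)"
  have "u \<in> R" using inverse_one_minus_mem[of "d n"] d(1) by (simp add: u_def)
  have "d n \<noteq> 1" using d(1) proper by metis
  then have "u * (1 - d n) = 1" by (simp add: u_def)
  moreover have "x ^ n * (1 - d n) = (\<Sum>i\<le>m. d i * x ^ i)"
  proof -
    have "(\<Sum>i\<le>n. d i * x ^ i) = (\<Sum>i\<le>m. d i * x ^ i) + d n * x ^ n" using Suc by simp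
    then have "x ^ n - d n * x ^ n = (\<Sum>i\<le>m. d i * x ^ i)"
      unfolding d(2)[symmetric] by (metis add_diff_cancel_right')
    then show ?thesis by (simp add: right_diff_distrib mult.commute)
  qed
  ultimately have leading: "x ^ n = u * (\<Sum>i\<le>m. d i * x ^ i)"
    by (metis mult.left_commute mult.right_neutral)
  have "1 = (\<Sum>i\<le>m. c i * x ^ i) + c n * x ^ n" using c(2) Suc by simp
  also have "\<dots> = (\<Sum>i\<le>m. (c i + d i * (c n * u)) * x ^ i)"
    unfolding leading by (simp add: sum_distrib_left sum.distrib algebra_simps)
  finally have "(\<Sum>i\<le>m. (c i + d i * (c n * u)) * x ^ i) = 1" by simp
  moreover have "c i + d i * (c n * u) \<in> J" for i
    using c(1) d(1) \<open>u \<in> R\<close> ideal_subset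
    by (intro generated_ideal_add generated_ideal_mult mult_mem) auto
  ultimately have "unit_relation m x"
    unfolding unit_relation_def by (intro exI[of _ "\<lambda>i. c i + d i * (c n * u)"]) simp
  then show ?thesis using Suc by blast
qed

lemma mem_or_inverse_mem: "x \<in> R \<or> inverse x \<in> R"
proof (rule ccontr)
  assume notin: "\<not> ?thesis"
  then have "x \<noteq> 0" by (auto simp: closed)
  define n where "n = (LEAST n. unit_relation n x)"
  define m where "m = (LEAST m. unit_relation m (inverse x))"
  have n: "unit_relation n x" and m: "unit_relation m (inverse x)"
    using notin exists_unit_relation LeastI_ex unfolding n_def m_def by metis+
  have "\<not> n' < n" if "unit_relation n' x" for n'
    using that Least_le not_less unfolding n_def by metis
  moreover have "\<not> m' < m" if "unit_relation m' (inverse x)" for m'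
    using that Least_le not_less unfolding m_def by metis
  ultimately show False
    using unit_relation_descent[of x n] unit_relation_descent[of "inverse x" m]
      unit_relation_mono[OF m, of n] unit_relation_mono[OF n, of m] n m \<open>x \<noteq> 0\<close>
    by (metis inverse_inverse_eq inverse_nonzero_iff_nonzero nle_le)
qed

sublocale valuation_subring R
  by unfold_locales (rule mem_or_inverse_mem)

lemma inverse_generator_not_mem:
  assumes "s \<in> S" "s \<noteq> 0"
  shows "inverse s \<notin> R"
  using generated_ideal_mult[OF generator_mem_generated_ideal[OF assms(1)], of "inverse s"]
    assms(2) proper
  by auto

end

theorem exists_valuation_subring:
  fixes R :: "'a::field set"
  assumes "subring R" "S \<subseteq> R" "1 \<notin> generated_ideal R S"
  obtains V where "valuation_subring V" "R \<subseteq> V" "\<And>s. s \<in> S \<Longrightarrow> s \<noteq> 0 \<Longrightarrow> inverse s \<notin> V"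
proof -
  define \<A> where "\<A> = {V. subring V \<and> R \<subseteq> V \<and> 1 \<notin> generated_ideal V S}"
  have "\<exists>M\<in>\<A>. \<forall>X\<in>\<A>. M \<subseteq> X \<longrightarrow> X = M"
  proof (rule subset_Zorn_nonempty)
    show "\<A> \<noteq> {}" using assms by (auto simp: \<A>_def)
    fix C assume C: "C \<noteq> {}" "subset.chain \<A> C"
    then have members: "\<And>V. V \<in> C \<Longrightarrow> subring V \<and> R \<subseteq> V \<and> 1 \<notin> generated_ideal V S"
      by (auto simp: subset_chain_def \<A>_def)
    then have "subset.chain {V. subring V} C" using C(2) by (simp add: subset_chain_def subset_iff)
    then show "\<Union>C \<in> \<A>"
      using C members subring_Union_chain[of C] generated_ideal_Union_chain[OF C, of 1]
      by (fastforce simp: \<A>_def)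
  qed
  then obtain V where V: "V \<in> \<A>" and max: "\<And>X. X \<in> \<A> \<Longrightarrow> V \<subseteq> X \<Longrightarrow> X = V" by blast
  then interpret V: maximal_subring_with_proper_ideal V S
    using assms(2)
    by (intro maximal_subring_with_proper_ideal.intro maximal_subring_with_proper_ideal_axioms.intro)
       (auto simp: \<A>_def)
  show thesis
    using that V V.valuation_subring_axioms V.inverse_generator_not_mem by (auto simp: \<A>_def)
qed

section \<open>Inner products and valuations\<close>

context valuation_subring
begin

definition infinitesimal :: "'a \<Rightarrow> bool" where
  "infinitesimal x \<longleftrightarrow> x = 0 \<or> inverse x \<notin> R"

lemma infinitesimal_mem: "infinitesimal x \<Longrightarrow> x \<in> R"
  using total[of x] by (auto simp: infinitesimal_def closed)

lemma one_not_infinitesimal: "\<not> infinitesimal 1"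
  by (simp add: infinitesimal_def closed)

lemma infinitesimal_inverse: "x \<notin> R \<Longrightarrow> infinitesimal (inverse x)"
  by (simp add: infinitesimal_def)

lemma infinitesimal_mult_right:
  assumes "infinitesimal x" "y \<in> R"
  shows "infinitesimal (x * y)"
proof (cases "x * y = 0")
  case False
  then have "inverse x = y * inverse (x * y)" by (simp add: field_simps)
  moreover have "inverse x \<notin> R" using assms False by (auto simp: infinitesimal_def)
  ultimately have "inverse (x * y) \<notin> R" using assms mult_mem by metis
  then show ?thesis by (simp add: infinitesimal_def)
qed (simp add: infinitesimal_def)

lemma infinitesimal_mult_left: "x \<in> R \<Longrightarrow> infinitesimal y \<Longrightarrow> infinitesimal (x * y)"
  using infinitesimal_mult_right[of y x] by (simp add: mult.commute)

lemma infinitesimal_uminus: "infinitesimal x \<Longrightarrow> infinitesimal (- x)"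
  using infinitesimal_mult_right[of x "- 1"] by (simp add: closed)

lemma infinitesimal_add:
  assumes "infinitesimal x" "infinitesimal y"
  shows "infinitesimal (x + y)"
proof (cases "x = 0 \<or> y = 0")
  case False
  then consider "x / y \<in> R" | "y / x \<in> R" using total[of "x / y"] by auto
  then show ?thesis
  proof cases
    case 1
    have "x + y = y * (x / y + 1)" using False by (simp add: field_simps)
    then show ?thesis using infinitesimal_mult_right[OF assms(2)] 1 by (simp add: closed)
  next
    case 2
    have "x + y = x * (1 + y / x)" using False by (simp add: field_simps)
    then show ?thesis using infinitesimal_mult_right[OF assms(1)] 2 by (simp add: closed)
  qed
qed (use assms in auto)

lemma infinitesimal_sum: "(\<And>i. i \<in> A \<Longrightarrow> infinitesimal (f i)) \<Longrightarrow> infinitesimal (sum f A)"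
  by (induction A rule: infinite_finite_induct)
     (auto simp: infinitesimal_add, auto simp: infinitesimal_def)

lemma exists_dominating:
  assumes "finite A" "\<not> A \<subseteq> {0}"
  shows "\<exists>m\<in>A. m \<noteq> 0 \<and> (\<forall>x\<in>A. x / m \<in> R)"
  using assms
proof (induction A)
  case (insert y A)
  show ?case
  proof (cases "A \<subseteq> {0}")
    case True
    then have "y \<noteq> 0" using insert.prems by auto
    then show ?thesis using True by (auto simp: closed)
  next
    case False
    then obtain m where m: "m \<in> A" "m \<noteq> 0" "\<forall>x\<in>A. x / m \<in> R" using insert.IH by blast
    show ?thesis
    proof (cases "y / m \<in> R")
      case True
      then show ?thesis using m by auto
    next
      case False
      then have "y \<noteq> 0" and ratio: "m / y \<in> R" using total[of "y / m"] by (auto simp: closed)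
      have "x / y \<in> R" if "x \<in> A" for x
        using mult_mem[OF m(3)[rule_format, OF that] ratio] m(2) by simp
      then show ?thesis using \<open>y \<noteq> 0\<close> by (auto simp: closed)
    qed
  qed
qed simp

definition unitriangular_mod_infinitesimals :: "nat \<Rightarrow> (nat \<Rightarrow> nat \<Rightarrow> 'a) \<Rightarrow> bool" where
  "unitriangular_mod_infinitesimals n A \<longleftrightarrow> (\<forall>i<n. A i i = 1) \<and>
     (\<forall>i<n. \<forall>j<i. infinitesimal (A i j)) \<and> (\<forall>j<n. \<forall>i<j. A i j \<in> R)"

lemma unitriangular_kernel_infinitesimal:
  assumes A: "unitriangular_mod_infinitesimals n A"
    and kernel: "\<And>j. j < n \<Longrightarrow> (\<Sum>i<n. s i * A i j) = 0" and mem: "\<And>i. i < n \<Longrightarrow> s i \<in> R"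
  shows "j < n \<Longrightarrow> infinitesimal (s j)"
proof (induction j rule: less_induct)
  case (less j)
  let ?rest = "\<Sum>i\<in>{..<n} - {j}. s i * A i j"
  have "0 = (\<Sum>i<n. s i * A i j)" using kernel less.prems by simp
  also have "\<dots> = s j * A j j + ?rest" using less.prems by (subst sum.remove[of _ j]) auto
  also have "A j j = 1" using A less.prems by (simp add: unitriangular_mod_infinitesimals_def)
  finally have "s j = - ?rest" by (simp add: eq_neg_iff_add_eq_0)
  moreover have "infinitesimal ?rest"
  proof (rule infinitesimal_sum)
    fix i assume "i \<in> {..<n} - {j}"
    then consider "i < j" | "j < i" "i < n" by fastforce
    then show "infinitesimal (s i * A i j)"
    proof cases
      case 1
      then show ?thesis
        using less A
        by (intro infinitesimal_mult_right) (auto simp: unitriangular_mod_infinitesimals_def)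
    next
      case 2
      then show ?thesis
        using A mem
        by (intro infinitesimal_mult_left) (auto simp: unitriangular_mod_infinitesimals_def)
    qed
  qed
  ultimately show ?case using infinitesimal_uminus by simp
qed

lemma unitriangular_kernel_trivial:
  assumes A: "unitriangular_mod_infinitesimals n A"
    and kernel: "\<And>j. j < n \<Longrightarrow> (\<Sum>i<n. t i * A i j) = 0" and "k < n"
  shows "t k = 0"
proof (rule ccontr)
  assume "t k \<noteq> 0"
  then have "\<not> t ` {..<n} \<subseteq> {0}" using \<open>k < n\<close> by auto
  then obtain l where l: "l < n" "t l \<noteq> 0" "\<And>i. i < n \<Longrightarrow> t i / t l \<in> R"
    using exists_dominating[of "t ` {..<n}"] by auto
  have "(\<Sum>i<n. t i / t l * A i j) = (\<Sum>i<n. t i * A i j) / t l" for j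
    by (simp add: sum_divide_distrib)
  then have "infinitesimal (t l / t l)"
    using kernel l by (intro unitriangular_kernel_infinitesimal[OF A, of "\<lambda>i. t i / t l"]) simp_all
  then show False using l(2) one_not_infinitesimal by simp
qed

end

lemma independent_family_card_le_DIM:
  fixes x :: "nat \<Rightarrow> 'b::euclidean_space"
  assumes "\<And>t k. (\<Sum>i<n. t i *\<^sub>R x i) = 0 \<Longrightarrow> k < n \<Longrightarrow> t k = 0"
  shows "n \<le> DIM('b)"
proof -
  have delta: "(\<Sum>k<n. of_bool (k = i) *\<^sub>R x k) = x i" if "i < n" for i
    using that by (subst sum.mono_neutral_right[of _ "{i}"]) auto
  have inj: "inj_on x {..<n}"
  proof (rule inj_onI, rule ccontr)
    fix i j assume ij: "i \<in> {..<n}" "j \<in> {..<n}" "x i = x j" "i \<noteq> j"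
    define t :: "nat \<Rightarrow> real" where "t k = of_bool (k = i) - of_bool (k = j)" for k
    have "(\<Sum>k<n. t k *\<^sub>R x k) = 0"
      using ij by (simp add: t_def scaleR_diff_left sum_subtractf delta)
    then have "t i = 0" using assms ij(1) by blast
    then show False using ij(4) by (simp add: t_def)
  qed
  have "independent (x ` {..<n})"
    unfolding dependent_finite[OF finite_imageI[OF finite_lessThan]]
  proof (intro notI, elim exE conjE bexE)
    fix u v assume "v \<in> x ` {..<n}" "u v \<noteq> 0" and "(\<Sum>v\<in>x ` {..<n}. u v *\<^sub>R v) = 0"
    moreover from this(3) have "(\<Sum>i<n. u (x i) *\<^sub>R x i) = 0"
      by (simp add: sum.reindex[OF inj])
    ultimately show False using assms[of "u \<circ> x"] by auto
  qed
  then have "card (x ` {..<n}) \<le> DIM('b)" using independent_bound by blast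
  then show ?thesis by (simp add: card_image[OF inj])
qed

locale real_valuation_subring = valuation_subring R for R :: "real set"
begin

text \<open>The Gram matrix of \<open>q, r, p, s\<close>, with its columns in reverse order, would otherwise be
  unitriangular modulo infinitesimals.\<close>

lemma inner_not_infinitesimal:
  fixes p q r s :: "'b::euclidean_space"
  assumes dim: "DIM('b) < 4"
    and unit: "p \<bullet> r = 1" "q \<bullet> s = 1"
    and mem: "p \<bullet> q \<in> R" "q \<bullet> q \<in> R" "q \<bullet> r \<in> R" "r \<bullet> r \<in> R"
    and small: "infinitesimal (p \<bullet> p)" "infinitesimal (r \<bullet> s)" "infinitesimal (s \<bullet> s)"
  shows "\<not> infinitesimal (p \<bullet> s)"
proof
  assume ps: "infinitesimal (p \<bullet> s)"
  define x where "x = (!) [q, r, p, s]"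
  define y where "y = (!) [s, p, r, q]"
  have less_4: "i < 4 \<longleftrightarrow> i = 0 \<or> i = 1 \<or> i = 2 \<or> i = 3" for i :: nat by auto
  have "x i \<bullet> y i = 1" if "i < 4" for i
    using that unit by (auto simp: less_4 x_def y_def inner_commute)
  moreover have "infinitesimal (x i \<bullet> y j)" if "j < i" "i < 4" for i j
    using that order.strict_trans[OF that] ps small
    by (auto simp: less_4 x_def y_def inner_commute)
  moreover have "x i \<bullet> y j \<in> R" if "i < j" "j < 4" for i j
    using that order.strict_trans[OF that] mem by (auto simp: less_4 x_def y_def inner_commute)
  ultimately have unitriangular: "unitriangular_mod_infinitesimals 4 (\<lambda>i j. x i \<bullet> y j)"
    by (simp add: unitriangular_mod_infinitesimals_def)
  have "t k = 0" if "(\<Sum>i<4. t i *\<^sub>R x i) = 0" "k < 4" for t k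
  proof (rule unitriangular_kernel_trivial[OF unitriangular _ that(2)])
    show "(\<Sum>i<4. t i * (x i \<bullet> y j)) = 0" for j
      using arg_cong[OF that(1), of "\<lambda>z. z \<bullet> y j"] by (simp add: inner_sum_left)
  qed
  then have "4 \<le> DIM('b)" by (rule independent_family_card_le_DIM)
  then show False using dim by simp
qed

lemma inner_product_growth:
  fixes p q r s :: "'b::euclidean_space"
  assumes dim: "DIM('b) < 4"
    and mem: "p \<bullet> p \<in> R" "q \<bullet> q \<in> R" "r \<bullet> r \<in> R" "s \<bullet> s \<in> R" "q \<bullet> r \<in> R" "r \<bullet> s \<in> R"
    and pr: "p \<bullet> r \<notin> R" and ratio: "(p \<bullet> q) / (p \<bullet> r) \<in> R" and qs: "q \<bullet> s \<notin> R"
  shows "p \<bullet> s \<notin> R \<and> (p \<bullet> r) / (p \<bullet> s) \<in> R"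
proof -
  define \<epsilon> where "\<epsilon> = inverse (p \<bullet> r)"
  define \<delta> where "\<delta> = inverse (q \<bullet> s)"
  have \<epsilon>: "infinitesimal \<epsilon>" and \<delta>: "infinitesimal \<delta>"
    using pr qs by (auto simp: \<epsilon>_def \<delta>_def infinitesimal_inverse)
  have unit: "\<epsilon> * (p \<bullet> r) = 1" "\<delta> * (q \<bullet> s) = 1"
    unfolding \<epsilon>_def \<delta>_def using pr qs zero_mem by (metis left_inverse)+
  have pq: "\<epsilon> * (p \<bullet> q) \<in> R" using ratio by (simp add: \<epsilon>_def divide_inverse mult.commute)
  have "\<not> infinitesimal ((\<epsilon> *\<^sub>R p) \<bullet> (\<delta> *\<^sub>R s))"
    using dim unit pq mem \<epsilon> \<delta>
    by (intro inner_not_infinitesimal[where q = q and r = r])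
       (simp_all add: infinitesimal_mult_right mult_mem infinitesimal_mem)
  then have not_small: "\<not> infinitesimal (\<delta> * ((p \<bullet> s) / (p \<bullet> r)))"
    "\<not> infinitesimal (\<epsilon> * (\<delta> * (p \<bullet> s)))"
    by (simp_all add: \<epsilon>_def divide_inverse mult_ac)
  then have "(p \<bullet> s) / (p \<bullet> r) \<notin> R" using infinitesimal_mult_right[OF \<delta>] by blast
  then have "(p \<bullet> r) / (p \<bullet> s) \<in> R" using total[of "(p \<bullet> r) / (p \<bullet> s)"] by simp
  moreover have "p \<bullet> s \<notin> R"
    using not_small(2) infinitesimal_mult_right[OF \<epsilon>] mult_mem infinitesimal_mem[OF \<delta>] by blast
  ultimately show ?thesis by blast
qed

lemma inner_product_walk:
  fixes x :: "nat \<Rightarrow> 'b::euclidean_space"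
  assumes "DIM('b) < 4"
    and "\<And>i. x i \<bullet> x i \<in> R" "\<And>i. x i \<bullet> x (Suc i) \<in> R" "\<And>i. x i \<bullet> x (i + 2) \<notin> R"
  shows "x i \<bullet> x (i + 2 + k) \<notin> R \<and> (x i \<bullet> x (i + 1 + k)) / (x i \<bullet> x (i + 2 + k)) \<in> R"
proof (induction k)
  case 0
  have "inverse (x i \<bullet> x (i + 2)) \<in> R" using total assms(4) by blast
  then show ?case using assms(3)[of i] assms(4)[of i] mult_mem by (simp add: divide_inverse)
next
  case (Suc k)
  show ?case
    using inner_product_growth[OF assms(1), of "x i" "x (i + 1 + k)" "x (i + 2 + k)" "x (i + 3 + k)"]
      assms(2) assms(3)[of "i + 1 + k"] assms(3)[of "i + 2 + k"] assms(4)[of "i + 1 + k"] Suc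
    by (simp add: eval_nat_numeral)
qed

definition near :: "'b::metric_space \<Rightarrow> 'b \<Rightarrow> bool" where
  "near x y \<longleftrightarrow> (dist x y)\<^sup>2 \<in> R"

lemma near_refl: "near x x"
  by (simp add: near_def zero_mem)

lemma near_commute: "near x y \<longleftrightarrow> near y x"
  by (simp add: near_def dist_commute)

lemma near_iff_inner_mem:
  fixes u x y :: "'b::real_inner"
  assumes half: "1 / 2 \<in> R" and "near u x" "near u y"
  shows "near x y \<longleftrightarrow> (x - u) \<bullet> (y - u) \<in> R"
proof -
  have "near x u" "near y u" using assms(2,3) near_commute by blast+
  then have self: "(x - u) \<bullet> (x - u) \<in> R" "(y - u) \<bullet> (y - u) \<in> R"
    by (simp_all add: near_def dist_norm power2_norm_eq_inner)
  have dist_square: "(dist x y)\<^sup>2 = (x - u) \<bullet> (x - u) + (y - u) \<bullet> (y - u) - 2 * ((x - u) \<bullet> (y - u))"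
    by (simp add: dist_norm power2_norm_eq_inner inner_diff inner_commute)
  have polarization: "(x - u) \<bullet> (y - u) =
      1 / 2 * ((x - u) \<bullet> (x - u) + (y - u) \<bullet> (y - u) - (dist x y)\<^sup>2)"
    by (simp add: dist_square)
  show ?thesis
  proof
    assume "near x y"
    then show "(x - u) \<bullet> (y - u) \<in> R"
      unfolding polarization near_def by (intro mult_mem diff_mem add_mem half self)
  next
    assume "(x - u) \<bullet> (y - u) \<in> R"
    then show "near x y"
      unfolding near_def dist_square mult_2 by (intro diff_mem add_mem self)
  qed
qed

lemma walk_without_shortcut_never_near_start:
  fixes x :: "nat \<Rightarrow> 'b::euclidean_space"
  assumes "DIM('b) < 4" "1 / 2 \<in> R"
    and "\<And>i. near u (x i)" "\<And>i. near (x i) (x (Suc i))" "\<And>i. \<not> near (x i) (x (i + 2))"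
  shows "\<not> near (x i) (x (i + 2 + k))"
proof -
  have near_iff: "near (x i) (x j) \<longleftrightarrow> (x i - u) \<bullet> (x j - u) \<in> R" for i j
    using near_iff_inner_mem assms(2,3) by blast
  show ?thesis
    unfolding near_iff
    by (rule inner_product_walk[OF assms(1), of "\<lambda>i. x i - u", THEN conjunct1])
       (use assms(4,5) near_refl in \<open>simp_all flip: near_iff\<close>)
qed

lemma finite_walk_has_shortcut:
  fixes x :: "nat \<Rightarrow> 'b::euclidean_space"
  assumes "DIM('b) < 4" "1 / 2 \<in> R" "finite (range x)"
    and "\<And>i. near u (x i)" "\<And>i. near (x i) (x (Suc i))"
  shows "\<exists>i. near (x i) (x (i + 2))"
proof (rule ccontr)
  assume "\<not> ?thesis"
  then have far: "\<not> near (x i) (x (i + 2 + k))" for i k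
    using walk_without_shortcut_never_near_start[OF assms(1,2)] assms(4,5) by blast
  have "\<not> inj x" using assms(3) finite_imageD by blast
  then obtain i j where ij: "i < j" "x i = x j"
    unfolding inj_def by (metis linorder_neqE_nat)
  from ij(1) consider "j = i + 1" | "i + 2 \<le> j" by linarith
  then show False
  proof cases
    case 1
    then show False using far[of i 0] assms(5)[of j] ij(2) by simp
  next
    case 2
    then obtain k where "j = i + 2 + k" using le_Suc_ex by blast
    then show False using far[of i k] near_refl ij(2) by metis
  qed
qed

end

section \<open>Chains modulo 2\<close>

lemma card_sym_diff:
  assumes "finite A" "finite B"
  shows "card (sym_diff A B) + 2 * card (A \<inter> B) = card A + card B"
proof -
  have "card (sym_diff A B) = card (A - B) + card (B - A)"
    using assms by (intro card_Un_disjoint) auto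
  moreover have "card A = card (A - B) + card (A \<inter> B)" "card B = card (B - A) + card (A \<inter> B)"
    using assms by (auto simp: Int_commute card_Diff_subset_Int card_mono le_add_diff_inverse2)
  ultimately show ?thesis by simp
qed

lemma card_cofaces:
  assumes "finite t" "e \<subseteq> t"
  shows "card {f. e \<subseteq> f \<and> f \<subseteq> t \<and> card f = Suc (card e)} = card (t - e)"
proof -
  have "finite e" using assms finite_subset by blast
  have "{f. e \<subseteq> f \<and> f \<subseteq> t \<and> card f = Suc (card e)} = (\<lambda>x. insert x e) ` (t - e)"
  proof (intro equalityI subsetI)
    fix f assume "f \<in> {f. e \<subseteq> f \<and> f \<subseteq> t \<and> card f = Suc (card e)}"
    then have f: "e \<subseteq> f" "f \<subseteq> t" "card f = Suc (card e)" by auto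
    then have "card (f - e) = 1" using \<open>finite e\<close> by (simp add: card_Diff_subset)
    then obtain x where "f - e = {x}" using card_1_singletonE by blast
    then have "f = insert x e" "x \<in> t - e" using f by auto
    then show "f \<in> (\<lambda>x. insert x e) ` (t - e)" by blast
  qed (use assms \<open>finite e\<close> in auto)
  moreover have "inj_on (\<lambda>x. insert x e) (t - e)" by (auto simp: inj_on_def)
  ultimately show ?thesis by (simp add: card_image)
qed

lemma edge_deg_eq_0: "(\<And>t. t \<in> T \<Longrightarrow> \<not> e \<subseteq> t) \<Longrightarrow> edge_deg T e = 0"
  unfolding edge_deg_def by (metis (no_types, lifting) Collect_empty_eq card.empty)

text \<open>Simplices are indexed by their number of vertices, not by their dimension.\<close>

definition chain_boundary :: "nat \<Rightarrow> 'v set set \<Rightarrow> 'v set set" where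
  "chain_boundary k T = {e. card e = k \<and> odd (edge_deg T e)}"

lemma chain_boundary_sym_diff:
  assumes "finite S" "finite T"
  shows "chain_boundary k (sym_diff S T) = sym_diff (chain_boundary k S) (chain_boundary k T)"
proof -
  have "odd (edge_deg (sym_diff S T) e) \<longleftrightarrow> odd (edge_deg S e) \<noteq> odd (edge_deg T e)" for e
  proof -
    have "{t \<in> sym_diff S T. e \<subseteq> t} = sym_diff {t \<in> S. e \<subseteq> t} {t \<in> T. e \<subseteq> t}" by auto
    then have "edge_deg (sym_diff S T) e + 2 * card ({t \<in> S. e \<subseteq> t} \<inter> {t \<in> T. e \<subseteq> t})
        = edge_deg S e + edge_deg T e"
      unfolding edge_deg_def using assms by (simp add: card_sym_diff)
    then show ?thesis by presburger
  qed
  then show ?thesis by (auto simp: chain_boundary_def)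
qed

lemma chain_boundary_singleton: "chain_boundary k {t} = {e. e \<subseteq> t \<and> card e = k}"
proof -
  have "{s \<in> {t}. e \<subseteq> s} = (if e \<subseteq> t then {t} else {})" for e by auto
  then show ?thesis by (auto simp: chain_boundary_def edge_deg_def)
qed

lemma chain_boundary_chain_boundary_singleton:
  assumes "card t = k + 2"
  shows "chain_boundary k (chain_boundary (Suc k) {t}) = {}"
proof -
  have "even (edge_deg (chain_boundary (Suc k) {t}) e)" if e: "card e = k" for e
  proof (cases "e \<subseteq> t")
    case True
    have "finite t" using assms card.infinite by fastforce
    then have "finite e" using True finite_subset by blast
    have "{f \<in> chain_boundary (Suc k) {t}. e \<subseteq> f} = {f. e \<subseteq> f \<and> f \<subseteq> t \<and> card f = Suc (card e)}"
      using e by (auto simp: chain_boundary_singleton)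
    then have "edge_deg (chain_boundary (Suc k) {t}) e = card (t - e)"
      using card_cofaces[OF \<open>finite t\<close> True] by (simp add: edge_deg_def)
    also have "\<dots> = 2" using assms e True \<open>finite e\<close> by (simp add: card_Diff_subset)
    finally show ?thesis by simp
  next
    case False
    then have "edge_deg (chain_boundary (Suc k) {t}) e = 0"
      by (intro edge_deg_eq_0) (auto simp: chain_boundary_singleton)
    then show ?thesis by simp
  qed
  then show ?thesis by (auto simp: chain_boundary_def)
qed

lemma card_sym_diff_triangle_less:
  assumes "finite E" "{a, b} \<in> E" "{b, c} \<in> E" "card {a, b, c} = 3"
  shows "card (sym_diff E (chain_boundary 2 {{a, b, c}})) < card E"
proof -
  let ?F = "chain_boundary 2 {{a, b, c}}"
  have "finite ?F" by (simp add: chain_boundary_singleton)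
  have "a \<noteq> b" "b \<noteq> c" "a \<noteq> c" using assms(4) by (auto simp: card_insert_if split: if_splits)
  then have "{{a, b}, {b, c}} \<subseteq> E \<inter> ?F" "card {{a, b}, {b, c}} = 2"
    using assms(2,3) by (simp_all add: chain_boundary_singleton doubleton_eq_iff)
  then have "2 \<le> card (E \<inter> ?F)" using assms(1) by (metis card_mono finite_Int)
  moreover have "card ?F = 3"
    using n_subsets[of "{a, b, c}" 2] assms(4) by (simp add: chain_boundary_singleton choose_two)
  ultimately show ?thesis using card_sym_diff[OF assms(1) \<open>finite ?F\<close>] by linarith
qed

lemma finite_link_edges: "finite T \<Longrightarrow> finite (link_edges T u)"
  by (simp add: link_edges_def Setcompr_eq_image)

lemma edge_deg_link_edges:
  assumes "u \<notin> e"
  shows "edge_deg (link_edges T u) e = edge_deg T (insert u e)"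
proof -
  have "{f \<in> link_edges T u. e \<subseteq> f} = (\<lambda>t. t - {u}) ` {t \<in> T. insert u e \<subseteq> t}"
    using assms by (auto simp: link_edges_def)
  moreover have "inj_on (\<lambda>t. t - {u}) {t \<in> T. insert u e \<subseteq> t}"
    by (auto simp: inj_on_def)
  ultimately show ?thesis by (simp only: edge_deg_def card_image)
qed

lemma chain_boundary_link_edges_eq_empty:
  assumes "0 < k" "u \<notin> \<Union>(chain_boundary (Suc k) T)"
  shows "chain_boundary k (link_edges T u) = {}"
proof -
  have "even (edge_deg (link_edges T u) e)" if e: "card e = k" for e
  proof (cases "u \<in> e")
    case True
    then have "edge_deg (link_edges T u) e = 0" by (intro edge_deg_eq_0) (auto simp: link_edges_def)
    then show ?thesis by simp
  next
    case False
    moreover have "finite e" using e assms(1) card_ge_0_finite by blast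
    ultimately have "card (insert u e) = Suc k" using e by simp
    then have "even (edge_deg T (insert u e))" using assms(2) by (auto simp: chain_boundary_def)
    then show ?thesis using False by (simp add: edge_deg_link_edges)
  qed
  then show ?thesis by (auto simp: chain_boundary_def)
qed

lemma mem_link_edges_iff:
  assumes "\<forall>t\<in>T. card t = Suc k" "u \<notin> e"
  shows "e \<in> link_edges T u \<longleftrightarrow> card e = k \<and> insert u e \<in> T"
proof
  assume "e \<in> link_edges T u"
  then obtain t where "t \<in> T" "u \<in> t" "e = t - {u}" by (auto simp: link_edges_def)
  then show "card e = k \<and> insert u e \<in> T"
    using assms(1) by (simp add: insert_absorb card_Diff_singleton)
next
  assume "card e = k \<and> insert u e \<in> T"
  then show "e \<in> link_edges T u"
    using assms(2) by (auto simp: link_edges_def intro!: exI[of _ "insert u e"])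
qed

lemma edge_deg_star:
  assumes "\<forall>t\<in>T. card t = Suc (card e)" "u \<notin> e"
  shows "edge_deg {t \<in> T. u \<in> t} e = of_bool (insert u e \<in> T)"
proof -
  have "t = insert u e" if t: "t \<in> T" "u \<in> t" "e \<subseteq> t" for t
  proof -
    have "card t = Suc (card e)" using assms(1) t(1) by blast
    moreover from this have "finite t" by (metis card_ge_0_finite zero_less_Suc)
    moreover from this have "finite e" using t(3) by (rule rev_finite_subset)
    ultimately show ?thesis using t assms(2) by (intro card_subset_eq[symmetric]) simp_all
  qed
  then have "{t \<in> {t \<in> T. u \<in> t}. e \<subseteq> t} = {t. t = insert u e \<and> t \<in> T}" by blast
  then show ?thesis by (simp add: edge_deg_def Collect_conv_if)
qed

lemma chain_boundary_star_eq_link_edges: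
  assumes card: "\<forall>t\<in>T. card t = Suc k" and interior: "u \<notin> \<Union>(chain_boundary k T)"
  shows "chain_boundary k {t \<in> T. u \<in> t} = link_edges T u"
proof (rule set_eqI)
  fix e
  show "e \<in> chain_boundary k {t \<in> T. u \<in> t} \<longleftrightarrow> e \<in> link_edges T u"
  proof (cases "u \<in> e")
    case True
    then have "{t \<in> {t \<in> T. u \<in> t}. e \<subseteq> t} = {t \<in> T. e \<subseteq> t}" by auto
    then have "e \<notin> chain_boundary k {t \<in> T. u \<in> t}"
      using True interior by (auto simp: chain_boundary_def edge_deg_def)
    then show ?thesis using True by (auto simp: link_edges_def)
  next
    case False
    then show ?thesis
      using edge_deg_star[of T e u] card
      by (auto simp: chain_boundary_def mem_link_edges_iff[OF card])
  qed
qed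

lemma even_graph_has_nonbacktracking_walk:
  assumes "finite E" "E \<noteq> {}" "\<forall>e\<in>E. card e = 2" "chain_boundary 1 E = {}"
  shows "\<exists>x :: nat \<Rightarrow> 'v. \<forall>n. {x n, x (Suc n)} \<in> E \<and> x (n + 2) \<noteq> x n"
proof -
  have continue: "\<exists>z. {y, z} \<in> E \<and> z \<noteq> x" if xy: "{x, y} \<in> E" for x y
  proof (rule ccontr)
    assume stuck: "\<not> ?thesis"
    have "{e \<in> E. {y} \<subseteq> e} = {{x, y}}"
    proof (intro equalityI subsetI)
      fix e assume "e \<in> {e \<in> E. {y} \<subseteq> e}"
      then have e: "e \<in> E" "y \<in> e" "card e = 2" using assms(3) by auto
      then obtain z where "e = {y, z}" by (auto simp: card_2_iff)
      with e stuck show "e \<in> {{x, y}}" by auto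
    qed (use xy in auto)
    then have "{y} \<in> chain_boundary 1 E" by (simp add: chain_boundary_def edge_deg_def)
    then show False using assms(4) by simp
  qed
  have "\<exists>f. \<forall>n::nat. {fst (f n), snd (f n)} \<in> E \<and>
      (fst (f (Suc n)) = snd (f n) \<and> snd (f (Suc n)) \<noteq> fst (f n))"
  proof (rule dependent_nat_choice)
    obtain e where "e \<in> E" "card e = 2" using assms(2,3) by blast
    then obtain a b where "{a, b} \<in> E" by (auto simp: card_2_iff)
    then show "\<exists>x. {fst x, snd x} \<in> E" by (intro exI[of _ "(a, b)"]) simp
    fix x :: "'v \<times> 'v" assume "{fst x, snd x} \<in> E"
    then obtain z where "{snd x, z} \<in> E" "z \<noteq> fst x" using continue by blast
    then show "\<exists>y. {fst y, snd y} \<in> E \<and> fst y = snd x \<and> snd y \<noteq> fst x"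
      by (intro exI[of _ "(snd x, z)"]) auto
  qed
  then obtain f where f: "\<And>n::nat. {fst (f n), snd (f n)} \<in> E"
    "\<And>n. fst (f (Suc n)) = snd (f n)" "\<And>n. snd (f (Suc n)) \<noteq> fst (f n)" by blast
  have "{fst (f n), fst (f (Suc n))} \<in> E \<and> fst (f (n + 2)) \<noteq> fst (f n)" for n
    using f(1)[of n] f(2)[of n] f(2)[of "Suc n"] f(3)[of n] by simp
  then show ?thesis by (intro exI[of _ "\<lambda>n. fst (f n)"]) blast
qed

section \<open>Elimination of interior vertices\<close>

locale shortcut_relation =
  fixes adj :: "'v \<Rightarrow> 'v \<Rightarrow> bool"
  assumes adj_refl: "adj x x"
    and adj_sym: "adj x y \<Longrightarrow> adj y x"
    and shortcut: "finite (range p) \<Longrightarrow> (\<And>i. adj u (p i)) \<Longrightarrow> (\<And>i. adj (p i) (p (Suc i)))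
      \<Longrightarrow> \<exists>i::nat. adj (p i) (p (i + 2))"
begin

definition clique :: "'v set \<Rightarrow> bool" where
  "clique s \<longleftrightarrow> (\<forall>x\<in>s. \<forall>y\<in>s. adj x y)"

definition clique_chain :: "nat \<Rightarrow> 'v set \<Rightarrow> 'v set set \<Rightarrow> bool" where
  "clique_chain k V T \<longleftrightarrow> finite T \<and> (\<forall>t\<in>T. card t = k \<and> clique t \<and> t \<subseteq> V)"

lemma clique_chain_sym_diff:
  "clique_chain k V S \<Longrightarrow> clique_chain k V T \<Longrightarrow> clique_chain k V (sym_diff S T)"
  by (auto simp: clique_chain_def)

lemma clique_chain_subset:
  "clique_chain k V T \<Longrightarrow> S \<subseteq> T \<Longrightarrow> \<Union>S \<subseteq> W \<Longrightarrow> clique_chain k W S"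
  by (auto simp: clique_chain_def dest: finite_subset)

lemma clique_chain_singleton:
  "card t = k \<Longrightarrow> clique t \<Longrightarrow> t \<subseteq> V \<Longrightarrow> clique_chain k V {t}"
  by (simp add: clique_chain_def)

lemma clique_chain_boundary_singleton:
  assumes "finite t" "clique t" "t \<subseteq> V"
  shows "clique_chain k V (chain_boundary k {t})"
  using assms by (auto simp: clique_chain_def chain_boundary_singleton clique_def)

lemma clique_chain_link_edges:
  assumes "clique_chain (Suc k) V T"
  shows "clique_chain k (\<Union>(link_edges T u)) (link_edges T u)"
proof -
  have "card f = k \<and> clique f" if f: "f \<in> link_edges T u" for f
  proof -
    obtain t where t: "t \<in> T" "u \<in> t" "f = t - {u}" using f by (auto simp: link_edges_def)
    then have "card t = Suc k" "clique t" using assms by (auto simp: clique_chain_def)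
    then show ?thesis using t(2,3) by (auto simp: clique_def card_Diff_singleton)
  qed
  then show ?thesis using assms finite_link_edges by (auto simp: clique_chain_def)
qed

lemma even_neighbourhood_graph_has_clique_corner:
  assumes E: "clique_chain 2 V E" "chain_boundary 1 E = {}" "E \<noteq> {}" and u: "\<forall>x\<in>V. adj u x"
  obtains a b c where "{a, b} \<in> E" "{b, c} \<in> E" "card {a, b, c} = 3" "clique {a, b, c}"
proof -
  have edges: "finite E" "\<forall>e\<in>E. card e = 2" using E(1) by (auto simp: clique_chain_def)
  obtain x where x: "\<And>n. {x n, x (Suc n)} \<in> E" "\<And>n. x (n + 2) \<noteq> x n"
    using even_graph_has_nonbacktracking_walk[OF edges(1) E(3) edges(2) E(2)] by blast
  have edge: "adj (x n) (x (Suc n))" "x n \<in> V" "x n \<noteq> x (Suc n)" for n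
  proof -
    have "card {x n, x (Suc n)} = 2" "clique {x n, x (Suc n)}" "{x n, x (Suc n)} \<subseteq> V"
      using E(1) x(1)[of n] by (auto simp: clique_chain_def)
    then show "adj (x n) (x (Suc n))" "x n \<in> V" "x n \<noteq> x (Suc n)" by (auto simp: clique_def)
  qed
  have "range x \<subseteq> \<Union>E" using x(1) by blast
  moreover have "finite (\<Union>E)"
    using edges by (intro finite_Union) (auto simp: card_2_iff)
  ultimately have "finite (range x)" by (rule finite_subset)
  then obtain i where i: "adj (x i) (x (i + 2))" using shortcut[of x u] edge(1,2) u by auto
  show thesis
  proof (rule that)
    show "{x i, x (Suc i)} \<in> E" "{x (Suc i), x (i + 2)} \<in> E"
      using x(1)[of i] x(1)[of "Suc i"] by simp_all
    show "card {x i, x (Suc i), x (i + 2)} = 3"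
      using edge(3)[of i] edge(3)[of "Suc i"] x(2)[of i] by simp
    show "clique {x i, x (Suc i), x (i + 2)}"
      using edge(1)[of i] edge(1)[of "Suc i"] i adj_refl adj_sym by (simp add: clique_def)
  qed
qed

lemma even_neighbourhood_graph_bounds:
  assumes "clique_chain 2 V E" "chain_boundary 1 E = {}" "\<forall>x\<in>V. adj u x"
  shows "\<exists>T. clique_chain 3 V T \<and> chain_boundary 2 T = E"
  using assms(1,2)
proof (induction "card E" arbitrary: E rule: less_induct)
  case less
  show ?case
  proof (cases "E = {}")
    case True
    then show ?thesis
      by (intro exI[of _ "{}"]) (simp add: clique_chain_def chain_boundary_def edge_deg_def)
  next
    case False
    obtain a b c where abc: "{a, b} \<in> E" "{b, c} \<in> E" and card: "card {a, b, c} = 3"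
      and clique: "clique {a, b, c}"
      using even_neighbourhood_graph_has_clique_corner[OF less.prems False assms(3)] .
    let ?t = "{a, b, c}"
    let ?F = "chain_boundary 2 {?t}"
    have "?t \<subseteq> V" using abc less.prems(1) by (auto simp: clique_chain_def)
    have fin: "finite E" "finite ?F"
      using less.prems(1) by (auto simp: clique_chain_def chain_boundary_singleton)
    have "card (sym_diff E ?F) < card E" by (rule card_sym_diff_triangle_less[OF fin(1) abc card])
    moreover have "clique_chain 2 V (sym_diff E ?F)"
      using less.prems(1) clique \<open>?t \<subseteq> V\<close>
      by (intro clique_chain_sym_diff clique_chain_boundary_singleton) auto
    moreover have "chain_boundary 1 (sym_diff E ?F) = {}"
    proof -
      have "chain_boundary 1 ?F = {}"
        using chain_boundary_chain_boundary_singleton[of ?t 1] card by (simp add: numeral_2_eq_2)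
      then show ?thesis using less.prems(2) by (simp only: chain_boundary_sym_diff[OF fin]) simp
    qed
    ultimately obtain T where T: "clique_chain 3 V T" "chain_boundary 2 T = sym_diff E ?F"
      using less.hyps by blast
    have "clique_chain 3 V (sym_diff T {?t})"
      using T(1) clique_chain_singleton[OF card clique \<open>?t \<subseteq> V\<close>] by (rule clique_chain_sym_diff)
    moreover have "chain_boundary 2 (sym_diff T {?t}) = sym_diff (sym_diff E ?F) ?F"
      using T by (simp add: chain_boundary_sym_diff clique_chain_def)
    ultimately show ?thesis by (intro exI[of _ "sym_diff T {?t}"]) auto
  qed
qed

text \<open>The star of \<open>u\<close> is replaced by a filling of its link.\<close>

lemma eliminate_interior_vertex:
  assumes T: "clique_chain 3 V T" and u: "u \<notin> \<Union>(chain_boundary 2 T)"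
  shows "\<exists>T'. clique_chain 3 (\<Union>T - {u}) T' \<and> chain_boundary 2 T' = chain_boundary 2 T"
proof -
  let ?star = "{t \<in> T. u \<in> t}" and ?link = "link_edges T u"
  have "finite T" "\<forall>t\<in>T. card t = Suc 2" using T by (auto simp: clique_chain_def)
  have "clique_chain 2 (\<Union>?link) ?link"
    using clique_chain_link_edges[of 2] T by (simp add: numeral_3_eq_3 numeral_2_eq_2)
  moreover have "chain_boundary 1 ?link = {}"
    using chain_boundary_link_edges_eq_empty[of 1] u by (simp add: numeral_2_eq_2)
  moreover have "\<forall>x\<in>\<Union>?link. adj u x"
  proof
    fix x assume "x \<in> \<Union>?link"
    then obtain t where "t \<in> T" "u \<in> t" "x \<in> t" by (auto simp: link_edges_def)
    then show "adj u x" using T by (auto simp: clique_chain_def clique_def)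
  qed
  ultimately obtain D where D: "clique_chain 3 (\<Union>?link) D" "chain_boundary 2 D = ?link"
    using even_neighbourhood_graph_bounds[of "\<Union>?link" ?link u] by blast
  have "\<Union>?link \<subseteq> \<Union>T - {u}" by (auto simp: link_edges_def)
  then have "clique_chain 3 (\<Union>T - {u}) D"
    using D(1) unfolding clique_chain_def by (meson subset_trans)
  moreover have "clique_chain 3 (\<Union>T - {u}) (T - ?star)"
    by (rule clique_chain_subset[OF T]) auto
  ultimately have "clique_chain 3 (\<Union>T - {u}) (sym_diff (T - ?star) D)"
    using clique_chain_sym_diff by blast
  moreover have "chain_boundary 2 (sym_diff (T - ?star) D) = chain_boundary 2 T"
  proof -
    have star: "chain_boundary 2 ?star = ?link"
      using \<open>\<forall>t\<in>T. card t = Suc 2\<close> u by (rule chain_boundary_star_eq_link_edges)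
    have "chain_boundary 2 (sym_diff (T - ?star) D) = sym_diff (chain_boundary 2 (T - ?star)) ?link"
      using \<open>finite T\<close> D by (subst chain_boundary_sym_diff) (simp_all add: clique_chain_def)
    also have "\<dots> = chain_boundary 2 (sym_diff (T - ?star) ?star)"
      using \<open>finite T\<close> star by (subst chain_boundary_sym_diff) simp_all
    also have "sym_diff (T - ?star) ?star = T" by auto
    finally show ?thesis .
  qed
  ultimately show ?thesis by blast
qed

lemma eliminate_interior_vertices:
  assumes "clique_chain 3 V T"
  shows "\<exists>T'. clique_chain 3 (\<Union>(chain_boundary 2 T)) T' \<and> chain_boundary 2 T' = chain_boundary 2 T"
  using assms
proof (induction "card (\<Union>T - \<Union>(chain_boundary 2 T))" arbitrary: V T rule: less_induct)
  case less
  show ?case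
  proof (cases "\<Union>T \<subseteq> \<Union>(chain_boundary 2 T)")
    case True
    then have "clique_chain 3 (\<Union>(chain_boundary 2 T)) T"
      by (rule clique_chain_subset[OF less.prems order.refl])
    then show ?thesis by blast
  next
    case False
    then obtain u where u: "u \<in> \<Union>T" "u \<notin> \<Union>(chain_boundary 2 T)" by blast
    obtain T' where T': "clique_chain 3 (\<Union>T - {u}) T'" "chain_boundary 2 T' = chain_boundary 2 T"
      using eliminate_interior_vertex[OF less.prems u(2)] by blast
    have "finite T" "\<forall>t\<in>T. card t = 3" using less.prems by (auto simp: clique_chain_def)
    then have "finite (\<Union>T)" by (metis card.infinite finite_Union zero_neq_numeral)
    moreover have "\<Union>T' \<subseteq> \<Union>T - {u}" using T'(1) by (auto simp: clique_chain_def)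
    ultimately have "card (\<Union>T' - \<Union>(chain_boundary 2 T')) < card (\<Union>T - \<Union>(chain_boundary 2 T))"
      unfolding T'(2) using u by (intro psubset_card_mono psubsetI) (simp, blast, blast)
    then show ?thesis using less.hyps[OF _ T'(1)] T'(2) by simp
  qed
qed

lemma boundary_edge_in_clique:
  assumes "clique_chain 3 V T" "{x, y} \<in> chain_boundary 2 T"
  obtains z where "z \<in> \<Union>(chain_boundary 2 T)" "z \<noteq> x" "z \<noteq> y" "adj x z" "adj y z"
proof -
  obtain T' where T': "clique_chain 3 (\<Union>(chain_boundary 2 T)) T'"
    "chain_boundary 2 T' = chain_boundary 2 T"
    using eliminate_interior_vertices[OF assms(1)] by blast
  have "odd (edge_deg T' {x, y})" and xy: "card {x, y} = 2"
    using assms(2) unfolding T'(2)[symmetric] by (simp_all add: chain_boundary_def)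
  then have "{t \<in> T'. {x, y} \<subseteq> t} \<noteq> {}" unfolding edge_deg_def by (metis card.empty even_zero)
  then obtain t where "t \<in> T'" "{x, y} \<subseteq> t" by blast
  then have t: "card t = 3" "clique t" "t \<subseteq> \<Union>(chain_boundary 2 T)" "x \<in> t" "y \<in> t"
    using T'(1) by (auto simp: clique_chain_def)
  have "card (t - {x, y}) = 1" using t xy by (simp add: card_Diff_subset)
  then obtain z where "t - {x, y} = {z}" using card_1_singletonE by blast
  then have "z \<in> t" "z \<noteq> x" "z \<noteq> y" by auto
  then show thesis using t by (intro that[of z]) (auto simp: clique_def)
qed

end

section \<open>Algebraic dependence of two real numbers\<close>

definition algebraically_dependent :: "real \<Rightarrow> real \<Rightarrow> bool" where
  "algebraically_dependent x y \<longleftrightarrow> (\<exists>P. P \<noteq> 0 \<and> eval2 P x y = 0)"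

lemma map_poly_add_hom:
  assumes "h 0 = 0" "\<And>a b. h (a + b) = h a + h b"
  shows "map_poly h (p + q) = map_poly h p + map_poly h q"
  by (rule poly_eqI) (simp add: coeff_map_poly assms)

lemma map_poly_mult_hom:
  fixes h :: "'a::comm_semiring_1 \<Rightarrow> 'b::comm_semiring_1"
  assumes "h 0 = 0" "\<And>a b. h (a + b) = h a + h b" "\<And>a b. h (a * b) = h a * h b"
  shows "map_poly h (p * q) = map_poly h p * map_poly h q"
  by (induction p) (simp_all add: map_poly_pCons map_poly_smult map_poly_add_hom assms)

lemma eval2_add: "eval2 (P + Q) x y = eval2 P x y + eval2 Q x y"
  unfolding eval2_def by (simp add: map_poly_add_hom of_rat_add)

lemma eval2_mult: "eval2 (P * Q) x y = eval2 P x y * eval2 Q x y"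
  unfolding eval2_def
  by (subst map_poly_mult_hom)
     (simp_all add: map_poly_add_hom map_poly_mult_hom of_rat_add of_rat_mult)

lemma eval2_diff: "eval2 (P - Q) x y = eval2 P x y - eval2 Q x y"
  using eval2_add[of "P - Q" Q x y] by simp

lemma eval2_monom: "eval2 (monom (monom c i) j) x y = of_rat c * x ^ i * y ^ j"
  by (simp add: eval2_def map_poly_monom poly_monom)

lemma eval2_sum: "eval2 (\<Sum>i\<in>A. P i) x y = (\<Sum>i\<in>A. eval2 (P i) x y)"
proof (induction A rule: infinite_finite_induct)
  case (insert i A)
  then show ?case by (simp add: eval2_add)
qed (simp_all add: eval2_def)

lemma eval2_altdef:
  assumes "\<And>j. degree (coeff P j) \<le> m"
  shows "eval2 P x y = (\<Sum>j\<le>degree P. \<Sum>i\<le>m. of_rat (coeff (coeff P j) i) * x ^ i * y ^ j)"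
proof -
  have "P = (\<Sum>j\<le>degree P. monom (coeff P j) j)" by (simp add: poly_as_sum_of_monoms)
  also have "\<dots> = (\<Sum>j\<le>degree P. \<Sum>i\<le>m. monom (monom (coeff (coeff P j) i) i) j)"
  proof (rule sum.cong[OF refl])
    fix j
    have "coeff P j = (\<Sum>i\<le>m. monom (coeff (coeff P j) i) i)"
      using assms by (simp add: poly_as_sum_of_monoms')
    then show "monom (coeff P j) j = (\<Sum>i\<le>m. monom (monom (coeff (coeff P j) i) i) j)"
      by (metis monom_sum)
  qed
  finally have "eval2 P x y =
      eval2 (\<Sum>j\<le>degree P. \<Sum>i\<le>m. monom (monom (coeff (coeff P j) i) i) j) x y"
    by simp
  then show ?thesis by (simp only: eval2_sum eval2_monom)
qed

definition reflect_poly2 :: "nat \<Rightarrow> nat \<Rightarrow> 'a::comm_monoid_add poly poly \<Rightarrow> 'a poly poly" where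
  "reflect_poly2 m n P = (\<Sum>j\<le>n. \<Sum>i\<le>m. monom (monom (coeff (coeff P j) i) (m - i)) (n - j))"

lemma coeff_reflect_poly2:
  assumes "i \<le> m" "j \<le> n"
  shows "coeff (coeff (reflect_poly2 m n P) (n - j)) (m - i) = coeff (coeff P j) i"
proof -
  have diff_eq: "k - l = k - l' \<longleftrightarrow> l = l'" if "l \<le> k" "l' \<le> k" for k l l' :: nat
    using that by auto
  have "coeff (coeff (reflect_poly2 m n P) (n - j)) (m - i) =
      (\<Sum>l\<le>n. \<Sum>k\<le>m. if l = j then if k = i then coeff (coeff P l) k else 0 else 0)"
    unfolding reflect_poly2_def coeff_sum using assms by (intro sum.cong refl) (auto simp: diff_eq)
  also have "\<dots> = (\<Sum>l\<le>n. if l = j then coeff (coeff P l) i else 0)"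
    using assms by (intro sum.cong refl) auto
  also have "\<dots> = coeff (coeff P j) i" using assms by simp
  finally show ?thesis .
qed

lemma eval2_reflect_poly2:
  assumes "x \<noteq> 0" "y \<noteq> 0" "\<And>j. degree (coeff P j) \<le> m"
  shows "eval2 (reflect_poly2 m (degree P) P) x y =
    x ^ m * y ^ degree P * eval2 P (inverse x) (inverse y)"
proof -
  have "eval2 (reflect_poly2 m (degree P) P) x y =
      (\<Sum>j\<le>degree P. \<Sum>i\<le>m. of_rat (coeff (coeff P j) i) * x ^ (m - i) * y ^ (degree P - j))"
    by (simp add: reflect_poly2_def eval2_sum eval2_monom)
  also have "\<dots> = x ^ m * y ^ degree P * eval2 P (inverse x) (inverse y)"
    unfolding eval2_altdef[OF assms(3)] sum_distrib_left
    using assms(1,2) by (intro sum.cong refl) (simp add: power_diff power_inverse divide_inverse)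
  finally show ?thesis .
qed

lemma algebraically_dependent_if_inverse:
  assumes "x \<noteq> 0" "y \<noteq> 0" "algebraically_dependent (inverse x) (inverse y)"
  shows "algebraically_dependent x y"
proof -
  obtain P where P: "P \<noteq> 0" "eval2 P (inverse x) (inverse y) = 0"
    using assms(3) by (auto simp: algebraically_dependent_def)
  define m where "m = Max ((\<lambda>j. degree (coeff P j)) ` {..degree P})"
  have deg: "degree (coeff P j) \<le> m" for j
    by (cases "j \<le> degree P") (auto simp: m_def coeff_eq_0)
  let ?Q = "reflect_poly2 m (degree P) P"
  let ?c = "lead_coeff P"
  have "eval2 ?Q x y = 0" using eval2_reflect_poly2[OF assms(1,2) deg] P(2) by simp
  moreover have "coeff (coeff ?Q 0) (m - degree ?c) = lead_coeff ?c"
    using coeff_reflect_poly2[of "degree ?c" m "degree P" "degree P" P] deg by simp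
  then have "?Q \<noteq> 0" using P(1) by auto
  ultimately show ?thesis by (auto simp: algebraically_dependent_def)
qed

definition rat_poly_values :: "real \<Rightarrow> real \<Rightarrow> real set" where
  "rat_poly_values x y = range (\<lambda>P. eval2 P x y)"

lemma rat_poly_valuesI: "z = eval2 P x y \<Longrightarrow> z \<in> rat_poly_values x y"
  by (simp add: rat_poly_values_def)

lemma of_rat_mem_rat_poly_values: "of_rat c \<in> rat_poly_values x y"
  by (rule rat_poly_valuesI[of _ "monom (monom c 0) 0"]) (simp only: eval2_monom, simp)

lemma variables_mem_rat_poly_values: "x \<in> rat_poly_values x y" "y \<in> rat_poly_values x y"
proof -
  show "x \<in> rat_poly_values x y"
    by (rule rat_poly_valuesI[of _ "monom (monom 1 1) 0"]) (simp only: eval2_monom, simp)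
  show "y \<in> rat_poly_values x y"
    by (rule rat_poly_valuesI[of _ "monom (monom 1 0) 1"]) (simp only: eval2_monom, simp)
qed

lemma subring_rat_poly_values: "subring (rat_poly_values x y)"
proof
  show "1 \<in> rat_poly_values x y" using of_rat_mem_rat_poly_values[of 1] by simp
  fix a b assume "a \<in> rat_poly_values x y" "b \<in> rat_poly_values x y"
  then obtain P Q where ab: "a = eval2 P x y" "b = eval2 Q x y" by (auto simp: rat_poly_values_def)
  show "a - b \<in> rat_poly_values x y"
    by (rule rat_poly_valuesI[of _ "P - Q"]) (simp add: ab eval2_diff)
  show "a * b \<in> rat_poly_values x y"
    by (rule rat_poly_valuesI[of _ "P * Q"]) (simp add: ab eval2_mult)
qed

lemma variables_generate_proper_ideal:
  assumes "\<not> algebraically_dependent x y"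
  shows "1 \<notin> generated_ideal (rat_poly_values x y) {x, y}"
proof
  assume "1 \<in> generated_ideal (rat_poly_values x y) {x, y}"
  then obtain P Q where PQ: "1 = x * eval2 P x y + y * eval2 Q x y"
    using subring.generated_ideal_pair_subset[OF subring_rat_poly_values, of x y x y]
    unfolding rat_poly_values_def by blast
  define G where "G = 1 - monom (monom 1 1) 0 * P - monom (monom 1 0) 1 * Q"
  have "coeff (coeff G 0) 0 = 1" by (simp add: G_def coeff_monom_mult coeff_mult)
  then have "G \<noteq> 0" by auto
  moreover have "eval2 G x y = 0"
    using PQ eval2_monom[of 1 0 0 x y] eval2_monom[of 1 0 1 x y]
    by (simp add: G_def eval2_diff eval2_mult eval2_monom monom_eq_1)
  ultimately show False using assms by (auto simp: algebraically_dependent_def)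
qed

lemma exists_valuation_subring_excluding:
  assumes "\<not> algebraically_dependent x y"
  obtains R where "valuation_subring R" "\<rat> \<subseteq> R" "x \<notin> R" "y \<notin> R"
proof -
  have "eval2 (monom (monom 1 1) 1) x y \<noteq> 0"
    using assms unfolding algebraically_dependent_def by (metis monom_eq_0_iff one_neq_zero)
  then have nonzero: "x \<noteq> 0" "y \<noteq> 0" by (auto simp: eval2_monom)
  let ?A = "rat_poly_values (inverse x) (inverse y)"
  have "1 \<notin> generated_ideal ?A {inverse x, inverse y}"
    using assms algebraically_dependent_if_inverse[OF nonzero]
    by (intro variables_generate_proper_ideal) blast
  then obtain R where R: "valuation_subring R" "?A \<subseteq> R"
    "\<And>s. s \<in> {inverse x, inverse y} \<Longrightarrow> s \<noteq> 0 \<Longrightarrow> inverse s \<notin> R"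
    using exists_valuation_subring[OF subring_rat_poly_values, of "{inverse x, inverse y}"]
      variables_mem_rat_poly_values by blast
  show thesis
  proof (rule that)
    show "\<rat> \<subseteq> R" using R(2) of_rat_mem_rat_poly_values unfolding Rats_def by blast
    show "x \<notin> R" "y \<notin> R" using R(3)[of "inverse x"] R(3)[of "inverse y"] nonzero by simp_all
  qed (rule R(1))
qed

section \<open>Domes\<close>

lemma chain_boundary_triangulated_surface:
  assumes "triangulated_surface T"
  shows "chain_boundary 2 T = boundary_edges T"
proof -
  have "odd (edge_deg T e) \<longleftrightarrow> e \<in> cplx_edges T \<and> edge_deg T e = 1" if "card e = 2" for e
  proof (cases "e \<in> cplx_edges T")
    case True
    then have "edge_deg T e = 1 \<or> edge_deg T e = 2"
      using assms by (simp add: triangulated_surface_def)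
    then show ?thesis using True by auto
  next
    case False
    then have "edge_deg T e = 0" using that by (intro edge_deg_eq_0) (auto simp: cplx_edges_def)
    then show ?thesis using False by simp
  qed
  then show ?thesis by (auto simp: chain_boundary_def boundary_edges_def cplx_edges_def)
qed

context real_valuation_subring
begin

lemma shortcut_relation_near:
  fixes f :: "'v \<Rightarrow> 'b::euclidean_space"
  assumes "DIM('b) < 4" "1 / 2 \<in> R"
  shows "shortcut_relation (\<lambda>x y. near (f x) (f y))"
proof
  show "near (f x) (f x)" for x by (rule near_refl)
  show "near (f x) (f y) \<Longrightarrow> near (f y) (f x)" for x y by (simp add: near_commute)
  fix p :: "nat \<Rightarrow> 'v" and u
  assume p: "finite (range p)" "\<And>i. near (f u) (f (p i))" "\<And>i. near (f (p i)) (f (p (Suc i)))"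
  have "finite (range (f \<circ> p))" using finite_imageI[OF p(1), of f] by (simp add: image_comp)
  then show "\<exists>i. near (f (p i)) (f (p (i + 2)))"
    using finite_walk_has_shortcut[OF assms, of "f \<circ> p" "f u"] p by simp
qed

lemma dome_boundary_edge_in_near_triangle:
  assumes "1 / 2 \<in> R" "is_dome T f n \<gamma>" "i < n"
  obtains k where "k < n" "k \<noteq> i" "k \<noteq> (i + 1) mod n"
    "near (\<gamma> i) (\<gamma> k)" "near (\<gamma> ((i + 1) mod n)) (\<gamma> k)"
proof -
  obtain w where w: "boundary_cycle T n w" "\<forall>i<n. f (w i) = \<gamma> i"
    and T: "triangulated_surface T" and unit: "\<forall>t\<in>T. \<forall>x\<in>t. \<forall>y\<in>t. x \<noteq> y \<longrightarrow> dist (f x) (f y) = 1"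
    using assms(2) by (auto simp: is_dome_def)
  interpret shortcut_relation "\<lambda>x y. near (f x) (f y)"
    using assms(1) by (intro shortcut_relation_near) simp
  have "clique_chain 3 UNIV T"
    unfolding clique_chain_def clique_def
  proof (intro conjI ballI)
    show "near (f x) (f y)" if "t \<in> T" "x \<in> t" "y \<in> t" for t x y
      using unit that near_refl one_mem by (cases "x = y") (auto simp: near_def)
  qed (use T in \<open>auto simp: triangulated_surface_def\<close>)
  have boundary: "chain_boundary 2 T = {{w j, w ((j + 1) mod n)} | j. j < n}"
    using w(1) chain_boundary_triangulated_surface[OF T] by (simp add: boundary_cycle_def)
  then have "{w i, w ((i + 1) mod n)} \<in> chain_boundary 2 T" using assms(3) by blast
  then obtain z where z: "z \<in> \<Union>(chain_boundary 2 T)" "z \<noteq> w i" "z \<noteq> w ((i + 1) mod n)"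
    "near (f (w i)) (f z)" "near (f (w ((i + 1) mod n))) (f z)"
    using boundary_edge_in_clique[OF \<open>clique_chain 3 UNIV T\<close>] by blast
  have next_less: "(j + 1) mod n < n" for j using assms(3) by simp
  obtain k where k: "k < n" "z = w k" using z(1) next_less unfolding boundary by blast
  show thesis
    by (rule that[of k]) (use z k w(2) assms(3) next_less[of i] in auto)
qed

end

theorem theorem1p1:
  fixes v :: "nat \<Rightarrow> real^3" and a b :: real
  assumes "a > 0" and "b > 0"
    and "unit_rhombus v a b"
    and "can_be_domed 4 v"
  shows "\<exists>P :: rat poly poly. P \<noteq> 0 \<and> eval2 P (a^2) (b^2) = 0"
proof (rule ccontr)
  assume "\<not> ?thesis"
  then have "\<not> algebraically_dependent (a\<^sup>2) (b\<^sup>2)" by (simp add: algebraically_dependent_def)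
  then obtain R where R: "valuation_subring R" "\<rat> \<subseteq> R" "a\<^sup>2 \<notin> R" "b\<^sup>2 \<notin> R"
    by (rule exists_valuation_subring_excluding)
  then interpret real_valuation_subring R by (simp add: real_valuation_subring_def)
  have half: "1 / 2 \<in> R" using R(2) by (auto intro: Rats_divide)
  obtain T :: "nat set set" and f where "is_dome T f 4 v"
    using assms(4) by (auto simp: can_be_domed_def)
  then obtain k where k: "k < 4" "k \<noteq> 0" "k \<noteq> 1" "near (v 0) (v k)" "near (v 1) (v k)"
    using dome_boundary_edge_in_near_triangle[OF half, of T f 4 v 0] by auto
  then consider "k = 2" | "k = 3" by linarith
  then have "near (v 0) (v 2) \<or> near (v 1) (v 3)" using k by cases auto
  then show False using R(3,4) assms(3) by (simp add: near_def unit_rhombus_def)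
qed

end
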